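(* Let $\lambda\ge1$, $k\ge1$ be integers, let $s$ be an even integer with $1\le s\le k$, and let $x$ be the frequency vector of an $\mathrm{OA}(\lambda 2^s,k,2,s)$ with symbols from $\{-1,1\}$. Let $$\Omega_1=\left\{d\in E[s+2,k]\ \middle|\ \lambda\binom{d-1}{d-s-1}\equiv 0 \pmod 2\right\},\qquad \Omega_1'=\begin{cases}\{k\}&\text{if $k$ is odd},\\ \emptyset&\text{otherwise}.\end{cases}$$ Let $Gx$ be the orbit of $x$ under $G=G(k)^{\mathrm{OD}}$. Then there exist $T\subseteq\Omega_1$ and $T'\subseteq\Omega_1'$ such that the following hold. (i) $$\dim\left(\mathrm{Conv}(Gx)\right)=2^k-\sum_{j=0}^s\binom{k}{j}-\sum_{d\in T}\left(\binom{k}{d-1}+\binom{k}{d}\right)-\delta_{(|T'|,1)},$$ where $\binom{k}{m}=0$ if $m>k$. (ii) The affine hull $\mathrm{Aff}(\mathrm{Conv}(Gx))=\mathrm{Aff}(Gx)$ is the set of all $z\in\mathbb{R}^{2^k}$ such that, for all $(i_1,\ldots,i_k)\in\{-1,1\}^k$: $J_\emptyset^{z}(i_1,\ldots,i_k)=\lambda 2^s$; $J_u^{z}(i_1,\ldots,i_k)=0$ for all $u\subseteq[k]$ with $1\le|u|\le s$; $J_{u''}^{z}(i_1,\ldots,i_k)=0$ for all $u''\subseteq[k]$ with $|u''|\in T\cup(T-1)$, where $T-1=\{d-1\mid d\in T\}$; and, if $|T'|=1$, $J_{[k]}^{z}(i_1,\ldots,i_k)=0$.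
   Context: $[k]=\{1,\ldots,k\}$; $E[a,b]$ is the set of even integers in $[a,b]$; $\delta_{(x,y)}=1$ if $x=y$ and $0$ otherwise. An orthogonal array $\mathrm{OA}(\lambda 2^s,k,2,s)$ is a $\lambda 2^s\times k$ array with entries in a two-element symbol set, here $\{-1,1\}$, such that in every choice of $s$ columns each of the $2^s$ symbol combinations appears as a row exactly $\lambda$ times. Its frequency vector $x\in\mathbb{Z}^{2^k}$, indexed by $\{-1,1\}^k$, counts how often each $(i_1,\ldots,i_k)$ appears as a row. For any real or complex vector $x$ indexed by $\{-1,1\}^k$ and $u\subseteq[k]$ define recursively $$x_u(i_1,\ldots,i_k)=2^{-k+|u|}\sum_{\{i_j\mid j\notin u\}}x(i_1,\ldots,i_k)-\sum_{v\subsetneq u}x_v(i_1,\ldots,i_k)$$ (the first sum is over all values of the indices $i_j$, $j\notin u$), and $J_u^{x}(i_1,\ldots,i_k)=2^kx_u(i_1,\ldots,i_k)$. $G(k)^{\mathrm{OD}}$ is the group of bijections of $\{-1,1\}^k$ generated by all permutations of the $k$ coordinates, all sign changes of individual coordinates, and the maps $R_j$ ($j\in[k]$), where $R_j(z)_j=z_j$ and $R_j(z)_i=z_iz_j$ for $i\ne j$. It acts on vectors indexed by $\{-1,1\}^k$ by permuting coordinates: $(gx)(g z)=x(z)$. The dimension of a convex set is the dimension of its affine hull. *)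

theory Defs
  imports
    "HOL-Analysis.Analysis"
    "HOL-Algebra.Bij"
    "HOL-Algebra.Generated_Groups"
    "HOL-Number_Theory.Cong"
begin

text \<open>
  Throughout, the column set \<open>[k]\<close> is the universe of a finite type \<open>'n\<close>, so that
  \<open>k = CARD('n)\<close>; the points of \<open>{-1,1}\<^sup>k\<close> are the functions \<open>'n \<Rightarrow> sign\<close>, and vectors
  indexed by them have type \<open>real ^ ('n \<Rightarrow> sign)\<close>.
\<close>

typedef sign = "{- 1, 1 :: int}"
  morphisms int_of_sign Abs_sign
  by auto

setup_lifting type_definition_sign

instantiation sign :: "{comm_monoid_mult, uminus}"
begin

lift_definition one_sign :: sign is 1
  by simp

lift_definition times_sign :: "sign \<Rightarrow> sign \<Rightarrow> sign" is "(*)"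
  by auto

lift_definition uminus_sign :: "sign \<Rightarrow> sign" is uminus
  by auto

instance
  by standard (transfer, simp add: ac_simps)+

end

lemma UNIV_sign: "UNIV = {- 1, 1 :: sign}"
proof -
  have "z = - 1 \<or> z = 1" for z :: sign
    by transfer auto
  then show ?thesis
    by auto
qed

lemma sign_neq [simp]: "- 1 \<noteq> (1 :: sign)"
  by transfer simp

instance sign :: finite
  by standard (simp add: UNIV_sign)

text \<open>An array is the list of its rows. A symbol combination on the columns in \<open>S\<close> is
  represented by any \<open>c\<close> defined on all columns; only its restriction to \<open>S\<close> matters.\<close>

definition orthogonal_array :: "nat \<Rightarrow> nat \<Rightarrow> ('n::finite \<Rightarrow> sign) list \<Rightarrow> bool" where
  "orthogonal_array lam s A \<longleftrightarrow>
     length A = lam * 2 ^ s \<and>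
     (\<forall>S c. card S = s \<longrightarrow> card {r. r < length A \<and> (\<forall>j\<in>S. (A ! r) j = c j)} = lam)"

definition frequency_vector :: "('n::finite \<Rightarrow> sign) list \<Rightarrow> real ^ ('n \<Rightarrow> sign)" where
  "frequency_vector A = (\<chi> z. real (count_list A z))"

function component ::
    "'a::field_char_0 ^ ('n::finite \<Rightarrow> sign) \<Rightarrow> 'n set \<Rightarrow> ('n \<Rightarrow> sign) \<Rightarrow> 'a" where
  "component x u i =
     2 powi (- int CARD('n) + int (card u)) * (\<Sum>z | \<forall>j\<in>u. z j = i j. x $ z)
       - (\<Sum>v | v \<subset> u. component x v i)"
  by pat_completeness auto
termination
  by (relation "Wellfounded.measure (\<lambda>(x, u, i). card u)") (auto intro: psubset_card_mono)

declare component.simps [simp del]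

definition J :: "'a::field_char_0 ^ ('n::finite \<Rightarrow> sign) \<Rightarrow> 'n set \<Rightarrow> ('n \<Rightarrow> sign) \<Rightarrow> 'a" where
  "J x u i = 2 ^ CARD('n) * component x u i"

definition permute_coords :: "('n \<Rightarrow> 'n) \<Rightarrow> ('n \<Rightarrow> sign) \<Rightarrow> ('n \<Rightarrow> sign)" where
  "permute_coords p z = z \<circ> p"

definition flip_coord :: "'n \<Rightarrow> ('n \<Rightarrow> sign) \<Rightarrow> ('n \<Rightarrow> sign)" where
  "flip_coord j z = z(j := - z j)"

definition R :: "'n \<Rightarrow> ('n \<Rightarrow> sign) \<Rightarrow> ('n \<Rightarrow> sign)" where
  "R j z = (\<lambda>i. if i = j then z j else z i * z j)"

definition G_OD :: "(('n::finite \<Rightarrow> sign) \<Rightarrow> ('n \<Rightarrow> sign)) set" where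
  "G_OD = generate (BijGroup UNIV)
     ({permute_coords p | p. bij p} \<union> range flip_coord \<union> range R)"

lemma sign_mult_self [simp]: "z * z = (1 :: sign)"
  by transfer auto

lemma sign_minus_minus [simp]: "- (- z) = (z :: sign)"
  by transfer simp

lemma bij_permute_coords: "bij p \<Longrightarrow> bij (permute_coords p)"
  by (rule o_bij[of "permute_coords (inv_into UNIV p)"])
    (auto simp: permute_coords_def fun_eq_iff bij_is_inj bij_is_surj surj_f_inv_f)

lemma bij_flip_coord: "bij (flip_coord j)"
  by (rule o_bij[of "flip_coord j"]) (auto simp: flip_coord_def)

lemma bij_R: "bij (R j)"
  by (rule o_bij[of "R j"]) (auto simp: R_def fun_eq_iff mult.assoc)

lemma bij_G_OD:
  assumes "g \<in> G_OD"
  shows "bij g"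
proof -
  have "G_OD \<subseteq> carrier (BijGroup UNIV)"
    unfolding G_OD_def
    by (rule group.generate_incl[OF group_BijGroup])
      (auto simp: BijGroup_def Bij_def extensional_def
        bij_permute_coords bij_flip_coord bij_R)
  with assms show ?thesis
    by (auto simp: BijGroup_def Bij_def)
qed

definition act ::
    "(('n::finite \<Rightarrow> sign) \<Rightarrow> ('n \<Rightarrow> sign)) \<Rightarrow> 'a ^ ('n \<Rightarrow> sign) \<Rightarrow> 'a ^ ('n \<Rightarrow> sign)" where
  "act g x = (\<chi> z. x $ inv_into UNIV g z)"

lemma act_apply: "bij g \<Longrightarrow> act g x $ g z = x $ z"
  by (simp add: act_def bij_is_inj)

definition orbit_OD :: "'a ^ ('n::finite \<Rightarrow> sign) \<Rightarrow> ('a ^ ('n \<Rightarrow> sign)) set" where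
  "orbit_OD x = (\<lambda>g. act g x) ` G_OD"

definition Omega1 :: "nat \<Rightarrow> nat \<Rightarrow> nat \<Rightarrow> nat set" where
  "Omega1 lam s k =
     {d. even d \<and> s + 2 \<le> d \<and> d \<le> k \<and> [lam * ((d - 1) choose (d - s - 1)) = 0] (mod 2)}"

definition Omega1' :: "nat \<Rightarrow> nat set" where
  "Omega1' k = (if odd k then {k} else {})"

end

theory Submission
  imports Defs
begin

text \<open>
  Everything is read off in the basis of the characters \<open>chi u z = \<Prod>j\<in>u. z j\<close>. Up to the sign
  \<open>chi u i\<close>, the value \<open>J x u i\<close> is the Fourier coefficient of \<open>x\<close> at \<open>u\<close> (\<open>J_eq_fourier\<close>), so
  the equations in the theorem say that certain Fourier coefficients vanish.

  The group contains all sign changes, that is, all translations of \<open>{-1,1}\<^sup>k\<close> regarded as the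
  group \<open>(\<int>/2)\<^sup>k\<close>. A space of vectors invariant under translations is spanned by the characters it
  contains. Hence the direction space of the affine hull of the orbit of \<open>x\<close> is spanned by those
  \<open>chi u\<close> for which \<open>u\<close> is nonempty and some vector of the orbit has a nonzero coefficient at \<open>u\<close>;
  such \<open>u\<close> are called active below. As characters are orthogonal, the dimension is the number of active
  sets, and the affine hull is cut out by fixing the coefficients at the inactive sets
  (\<open>affine_hull_orbit\<close>, \<open>aff_dim_orbit\<close>).

  Which sets are active is decided by their sizes. The group permutes the characters up to sign.
  Coordinate permutations join all sets of equal size, and \<open>R j\<close> joins \<open>u\<close> and \<open>insert j u\<close> when
  \<open>card u\<close> is odd. So sizes \<open>d - 1\<close> and \<open>d\<close> with \<open>d\<close> even are active together or not at all, and for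
  odd \<open>k\<close> the size \<open>k\<close> stands alone. An orthogonal array of even strength \<open>s\<close> has vanishing
  coefficients at sizes \<open>1, \<dots>, s\<close>, which fill complete pairs, so these are inactive. The
  remaining inactive pairs form \<open>T\<close>, and \<open>T'\<close> records whether the lone size \<open>k\<close> is inactive
  (\<open>active_iff_card\<close>).

  That \<open>T\<close> lies in \<open>\<Omega>\<^sub>1\<close> is a congruence: writing each entry as \<open>1\<close> minus twice an indicator and
  counting rows, the coefficient at \<open>u\<close> is \<open>2\<^sup>s\<close> times an integer of the same parity as
  \<open>\<lambda> (card u - 1 choose s)\<close> (\<open>fourier_array_mod\<close>). If the coefficient is zero, this number is even.
\<close>

section \<open>Characters and Fourier coefficients\<close>

definition sval :: "sign \<Rightarrow> real" where
  "sval b = real_of_int (int_of_sign b)"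

lemma sval_one [simp]: "sval 1 = 1"
  by (simp add: sval_def one_sign.rep_eq)

lemma sval_minus [simp]: "sval (- b) = - sval b"
  by (simp add: sval_def uminus_sign.rep_eq)

lemma sval_mult: "sval (a * b) = sval a * sval b"
  by (simp add: sval_def times_sign.rep_eq)

lemma sval_square [simp]: "sval b * sval b = 1"
  by (simp flip: sval_mult)

lemma sign_cases: "b = 1 \<or> b = (- 1 :: sign)"
  using UNIV_sign by auto

lemma one_neq_minus_one_sign [simp]: "(1 :: sign) \<noteq> - 1"
  using sign_neq by metis

lemma sval_mult_eq: "sval a * sval b = (if a = b then 1 else - 1)"
  using sign_cases[of a] sign_cases[of b] by auto

definition chi :: "'n::finite set \<Rightarrow> ('n \<Rightarrow> sign) \<Rightarrow> real" where
  "chi u z = (\<Prod>j\<in>u. sval (z j))"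

lemma chi_empty [simp]: "chi {} z = 1"
  by (simp add: chi_def)

lemma chi_square [simp]: "chi u z * chi u z = 1"
  by (simp add: chi_def flip: prod.distrib)

lemma chi_nonzero [simp]: "chi u z \<noteq> 0"
  using chi_square[of u z] by (metis mult_zero_left zero_neq_one)

lemma chi_flip_coord: "chi u (flip_coord j z) = (if j \<in> u then - chi u z else chi u z)"
proof (cases "j \<in> u")
  case True
  then have "chi u (flip_coord j z) = sval (- z j) * (\<Prod>i\<in>u - {j}. sval (flip_coord j z i))"
    by (simp add: chi_def prod.remove[of u j] flip_coord_def)
  also have "(\<Prod>i\<in>u - {j}. sval (flip_coord j z i)) = (\<Prod>i\<in>u - {j}. sval (z i))"
    by (rule prod.cong) (auto simp: flip_coord_def)
  finally show ?thesis
    using True by (simp add: chi_def prod.remove[of u j])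
next
  case False
  then show ?thesis
    by (auto simp: chi_def flip_coord_def intro!: prod.cong)
qed

text \<open>
  Expanding \<open>\<Prod>j\<in>u. (z j * w j + 1)\<close> gives the sum, and the product detects agreement on \<open>u\<close>. With
  \<open>u = UNIV\<close> this is Fourier inversion; for general \<open>u\<close> it evaluates the partial sums in the
  recursive definition of \<open>component\<close>.
\<close>

lemma sum_chi_subsets:
  "(\<Sum>v\<in>Pow u. chi v z * chi v w) = (if \<forall>j\<in>u. z j = w j then 2 ^ card u else 0)"
proof -
  have "(\<Sum>v\<in>Pow u. chi v z * chi v w) = (\<Prod>j\<in>u. sval (z j) * sval (w j) + 1)"
    by (simp add: prod_add chi_def flip: prod.distrib)
  also have "\<dots> = (\<Prod>j\<in>u. if z j = w j then 2 else 0)"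
    by (rule prod.cong) (auto simp: sval_mult_eq)
  also have "\<dots> = (if \<forall>j\<in>u. z j = w j then 2 ^ card u else 0)"
    by (auto intro: prod_zero)
  finally show ?thesis .
qed

lemma card_points: "CARD('n::finite \<Rightarrow> sign) = 2 ^ CARD('n)"
  by (simp add: card_fun UNIV_sign numeral_2_eq_2)

text \<open>
  If \<open>j\<close> lies in exactly one of two sets, then flipping coordinate \<open>j\<close> negates every summand, so the
  sum equals its own negative.
\<close>

lemma chi_orthogonal:
  fixes u v :: "'n::finite set"
  shows "(\<Sum>z\<in>UNIV. chi u z * chi v z) = (if u = v then 2 ^ CARD('n) else 0)"
proof (cases "u = v")
  case True
  then show ?thesis
    by (simp add: card_points)
next
  case False
  then obtain j where j: "j \<in> u \<longleftrightarrow> j \<notin> v"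
    by auto
  have "(\<Sum>z\<in>UNIV. chi u z * chi v z)
      = (\<Sum>z\<in>UNIV. chi u (flip_coord j z) * chi v (flip_coord j z))"
    by (rule sum.reindex_bij_betw[symmetric]) (rule bij_flip_coord)
  also have "\<dots> = (\<Sum>z\<in>UNIV. - (chi u z * chi v z))"
    using j by (intro sum.cong) (auto simp: chi_flip_coord)
  finally show ?thesis
    using False by (simp add: sum_negf)
qed

definition fourier :: "real ^ ('n::finite \<Rightarrow> sign) \<Rightarrow> 'n set \<Rightarrow> real" where
  "fourier x u = (\<Sum>z\<in>UNIV. chi u z * x $ z)"

definition chi_vec :: "'n::finite set \<Rightarrow> real ^ ('n \<Rightarrow> sign)" where
  "chi_vec u = (\<chi> z. chi u z)"

lemma fourier_eq_inner: "fourier x u = chi_vec u \<bullet> x"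
  by (simp add: fourier_def chi_vec_def inner_vec_def)

lemma fourier_chi_vec:
  "fourier (chi_vec v) (u :: 'n::finite set) = (if u = v then 2 ^ CARD('n) else 0)"
  by (simp add: fourier_def chi_vec_def chi_orthogonal)

lemma fourier_inversion:
  fixes x :: "real ^ ('n::finite \<Rightarrow> sign)"
  shows "x = (\<Sum>u\<in>UNIV. (fourier x u / 2 ^ CARD('n)) *\<^sub>R chi_vec u)"
proof (rule vec_eq_iff[THEN iffD2], rule allI)
  fix z
  have "(\<Sum>u\<in>UNIV. (fourier x u / 2 ^ CARD('n)) *\<^sub>R chi_vec u) $ z
      = (\<Sum>u\<in>UNIV. \<Sum>w\<in>UNIV. x $ w * (chi u w * chi u z) / 2 ^ CARD('n))"
    by (simp add: chi_vec_def fourier_def sum_distrib_right sum_distrib_left sum_divide_distrib mult_ac)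
  also have "\<dots> = (\<Sum>w\<in>UNIV. x $ w * (\<Sum>u\<in>Pow UNIV. chi u w * chi u z) / 2 ^ CARD('n))"
    by (subst sum.swap) (simp add: sum_distrib_left sum_divide_distrib)
  also have "\<dots> = (\<Sum>w\<in>UNIV. if w = z then x $ w else 0)"
    unfolding sum_chi_subsets by (rule sum.cong) (auto simp: fun_eq_iff)
  finally show "x $ z = (\<Sum>u\<in>UNIV. (fourier x u / 2 ^ CARD('n)) *\<^sub>R chi_vec u) $ z"
    by simp
qed

text \<open>
  By \<open>sum_chi_subsets\<close>, the claimed values summed over all subsets of \<open>u\<close> give the normalised partial
  sum of \<open>x\<close>. The recursion determines \<open>component\<close> from this identity, as it subtracts the proper
  subsets.
\<close>

lemma component_eq_fourier:
  fixes x :: "real ^ ('n::finite \<Rightarrow> sign)"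
  shows "component x u i = chi u i * fourier x u / 2 ^ CARD('n)"
proof (induction u rule: finite_psubset_induct[OF finite])
  case (1 u)
  have "(\<Sum>v\<in>Pow u. chi v i * fourier x v)
      = (\<Sum>z\<in>UNIV. x $ z * (\<Sum>v\<in>Pow u. chi v z * chi v i))"
    unfolding fourier_def sum_distrib_left by (subst sum.swap) (simp add: mult_ac)
  also have "\<dots> = (\<Sum>z\<in>UNIV. if \<forall>j\<in>u. z j = i j then 2 ^ card u * x $ z else 0)"
    unfolding sum_chi_subsets by (rule sum.cong) auto
  also have "\<dots> = 2 ^ card u * (\<Sum>z | \<forall>j\<in>u. z j = i j. x $ z)"
    by (simp add: sum_distrib_left sum.If_cases)
  finally have full: "(\<Sum>v\<in>Pow u. chi v i * fourier x v)
      = 2 ^ card u * (\<Sum>z | \<forall>j\<in>u. z j = i j. x $ z)" .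
  have "Pow u = insert u {v. v \<subset> u}"
    by auto
  then have split: "(\<Sum>v\<in>Pow u. chi v i * fourier x v)
      = chi u i * fourier x u + (\<Sum>v | v \<subset> u. chi v i * fourier x v)"
    by simp
  have "(\<Sum>v | v \<subset> u. component x v i) = (\<Sum>v | v \<subset> u. chi v i * fourier x v / 2 ^ CARD('n))"
    using 1 by (intro sum.cong) auto
  moreover have "(2::real) powi (- int CARD('n) + int (card u)) = 2 ^ card u / 2 ^ CARD('n)"
    by (simp add: power_int_add power_int_diff field_simps)
  ultimately have "component x u i
      = (2 ^ card u * (\<Sum>z | \<forall>j\<in>u. z j = i j. x $ z)
          - (\<Sum>v | v \<subset> u. chi v i * fourier x v)) / 2 ^ CARD('n)"
    by (simp add: component.simps[of x u i] diff_divide_distrib flip: sum_divide_distrib)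
  then show ?case
    using full split by simp
qed

lemma J_eq_fourier: "J x u i = chi u i * fourier x u"
  for x :: "real ^ ('n::finite \<Rightarrow> sign)"
  by (simp add: J_def component_eq_fourier)

lemma J_eq_0_iff [simp]: "J x u i = 0 \<longleftrightarrow> fourier x u = 0"
  for x :: "real ^ ('n::finite \<Rightarrow> sign)"
  by (simp add: J_eq_fourier)

section \<open>Generators of the group\<close>

lemma bij_group_simps:
  "\<one>\<^bsub>BijGroup UNIV\<^esub> = id"
  "g \<in> carrier (BijGroup UNIV) \<longleftrightarrow> bij g"
  "bij g \<Longrightarrow> bij h \<Longrightarrow> g \<otimes>\<^bsub>BijGroup UNIV\<^esub> h = g \<circ> h"
  by (auto simp: BijGroup_def Bij_def extensional_def compose_def fun_eq_iff)

lemma id_in_G_OD: "id \<in> G_OD"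
  using generate.one[of "BijGroup UNIV"] by (simp add: G_OD_def bij_group_simps)

lemma permute_coords_in_G_OD: "bij p \<Longrightarrow> permute_coords p \<in> G_OD"
  and flip_coord_in_G_OD: "flip_coord j \<in> G_OD"
  and R_in_G_OD: "R j \<in> G_OD"
  unfolding G_OD_def by (auto intro!: generate.incl)

lemma comp_in_G_OD:
  assumes "g \<in> G_OD" "h \<in> G_OD"
  shows "g \<circ> h \<in> G_OD"
  using generate.eng[OF assms[unfolded G_OD_def]] assms[THEN bij_G_OD]
  by (simp add: G_OD_def bij_group_simps)

lemma permute_coords_inverse: "bij p \<Longrightarrow> permute_coords (inv_into UNIV p) \<circ> permute_coords p = id"
  by (auto simp: permute_coords_def fun_eq_iff bij_is_surj surj_f_inv_f)

lemma flip_coord_inverse: "flip_coord j \<circ> flip_coord j = id"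
  by (auto simp: flip_coord_def fun_eq_iff)

lemma R_inverse: "R j \<circ> R j = id"
  by (auto simp: R_def fun_eq_iff mult.assoc)

text \<open>
  The generating set is closed under inverses, so inverses of generators need no case of their own.
\<close>

lemma G_OD_induct [consumes 1, case_names id permute flip R comp]:
  assumes "g \<in> G_OD"
    and id: "P id"
    and permute: "\<And>p. bij p \<Longrightarrow> P (permute_coords p)"
    and flip: "\<And>j. P (flip_coord j)"
    and R: "\<And>j. P (R j)"
    and comp: "\<And>g h. g \<in> G_OD \<Longrightarrow> h \<in> G_OD \<Longrightarrow> P g \<Longrightarrow> P h \<Longrightarrow> P (g \<circ> h)"
  shows "P g"
  using \<open>g \<in> G_OD\<close> unfolding G_OD_def
proof (induction g rule: generate.induct)
  case one
  then show ?case using id by (simp add: bij_group_simps id_def)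
next
  case (incl h)
  then show ?case using permute flip R by auto
next
  case (inv h)
  have inverse: "inv\<^bsub>BijGroup UNIV\<^esub> h = h'" if "bij h" "bij h'" "h' \<circ> h = id" for h'
    using that by (intro group.inv_equality[OF group_BijGroup]) (simp_all add: bij_group_simps)
  from inv consider p where "bij p" "h = permute_coords p" | j where "h = flip_coord j"
    | j where "h = R j"
    by auto
  then show ?case
  proof cases
    case 1
    then have "inv\<^bsub>BijGroup UNIV\<^esub> h = permute_coords (inv_into UNIV p)"
      by (intro inverse)
        (auto simp: bij_permute_coords permute_coords_inverse bij_imp_bij_inv)
    then show ?thesis using 1 permute by (simp add: bij_imp_bij_inv)
  next
    case 2
    then have "inv\<^bsub>BijGroup UNIV\<^esub> h = h"
      by (intro inverse) (simp_all add: bij_flip_coord flip_coord_inverse)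
    then show ?thesis using 2 flip by simp
  next
    case 3
    then have "inv\<^bsub>BijGroup UNIV\<^esub> h = h"
      by (intro inverse) (simp_all add: bij_R R_inverse)
    then show ?thesis using 3 R by simp
  qed
next
  case (eng g h)
  then show ?case
    using comp[of g h] bij_G_OD[of g] bij_G_OD[of h]
    by (simp add: G_OD_def bij_group_simps comp_def)
qed

lemma act_comp: "bij g \<Longrightarrow> bij h \<Longrightarrow> act (g \<circ> h) x = act g (act h x)"
  by (simp add: act_def o_inv_distrib)

lemma act_id [simp]: "act id x = x"
  by (simp add: act_def vec_eq_iff)

lemma fourier_act: "bij g \<Longrightarrow> fourier (act g x) u = (\<Sum>z\<in>UNIV. chi u (g z) * x $ z)"
  unfolding fourier_def
  by (subst sum.reindex_bij_betw[of g UNIV UNIV, symmetric]) (auto simp: act_apply)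


lemma fourier_diff: "fourier (x - y) u = fourier x u - fourier y u"
  by (simp add: fourier_eq_inner inner_diff_right)

section \<open>Action of the group on characters\<close>

lemma chi_permute_coords: "bij p \<Longrightarrow> chi u (permute_coords p z) = chi (p ` u) z"
  by (simp add: chi_def permute_coords_def prod.reindex inj_on_subset[OF bij_is_inj])

lemma chi_insert: "j \<notin> u \<Longrightarrow> chi (insert j u) z = sval (z j) * chi u z"
  by (simp add: chi_def)

text \<open>
  The map \<open>R j\<close> multiplies each coordinate other than \<open>j\<close> by \<open>z j\<close>, so it contributes \<open>z j\<close> to the
  power \<open>card u\<close>, of which only the parity matters.
\<close>

lemma chi_R_notin:
  assumes "j \<notin> u"
  shows "chi u (R j z) = (if even (card u) then chi u z else chi (insert j u) z)"
proof -
  have "chi u (R j z) = (\<Prod>i\<in>u. sval (z i) * sval (z j))"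
    unfolding chi_def using assms by (intro prod.cong) (auto simp: R_def sval_mult)
  also have "\<dots> = chi u z * sval (z j) ^ card u"
    by (simp add: chi_def prod.distrib)
  also have "sval (z j) ^ card u = (if even (card u) then 1 else sval (z j))"
    by (auto elim!: evenE oddE simp: power_mult power2_eq_square)
  finally show ?thesis
    using assms by (simp add: chi_insert)
qed

lemma chi_R_insert:
  assumes "j \<notin> u"
  shows "chi (insert j u) (R j z) = (if even (card u) then chi (insert j u) z else chi u z)"
proof -
  have "chi (insert j u) (R j z) = sval (z j) * chi u (R j z)"
    using assms by (simp add: chi_insert R_def)
  also have "sval (z j) * chi (insert j u) z = chi u z"
    using assms by (simp add: chi_insert flip: mult.assoc)
  then have "sval (z j) * chi u (R j z) = (if even (card u) then chi (insert j u) z else chi u z)"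
    using assms by (simp add: chi_R_notin chi_insert)
  finally show ?thesis .
qed

text \<open>
  The invariant of the action on sets: sizes \<open>2m - 1\<close> and \<open>2m\<close> have level \<open>m\<close>, and only the empty set
  has level \<open>0\<close>.
\<close>

definition level :: "'n::finite set \<Rightarrow> nat" where
  "level u = (card u + 1) div 2"

lemma level_insert_odd: "odd (card u) \<Longrightarrow> j \<notin> u \<Longrightarrow> level (insert j u) = level u"
  by (auto simp: level_def elim!: oddE)

text \<open>
  Sign changes keep the set, permutations keep its size, and \<open>R j\<close> moves the size at most between
  \<open>2m - 1\<close> and \<open>2m\<close>.
\<close>

lemma G_OD_permutes_chi:
  assumes "g \<in> G_OD"
  shows "\<exists>c v. level v = level u \<and> (\<forall>z. chi u (g z) = c * chi v z)"
  using assms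
proof (induction g arbitrary: u rule: G_OD_induct)
  case id
  show ?case
    by (intro exI[of _ 1] exI[of _ u]) simp
next
  case (permute p)
  then have "level (p ` u) = level u"
    by (simp add: level_def card_image inj_on_subset[OF bij_is_inj])
  with permute show ?case
    by (intro exI[of _ 1] exI[of _ "p ` u"]) (simp add: chi_permute_coords)
next
  case (flip j)
  show ?case
    by (intro exI[of _ "if j \<in> u then - 1 else 1"] exI[of _ u]) (simp add: chi_flip_coord)
next
  case (R j)
  define v where "v = u - {j}"
  have j: "j \<notin> v" and u: "u = v \<or> u = insert j v"
    by (auto simp: v_def)
  have "\<exists>w. level w = level u \<and> (\<forall>z. chi u (R j z) = chi w z)"
  proof (cases "even (card v)")
    case True
    then show ?thesis
      using u j by (intro exI[of _ u]) (auto simp: chi_R_notin chi_R_insert)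
  next
    case False
    then show ?thesis
      using u j by (intro exI[of _ "if u = v then insert j v else v"])
        (auto simp: chi_R_notin chi_R_insert level_insert_odd)
  qed
  then obtain w where "level w = level u" "\<And>z. chi u (R j z) = chi w z"
    by blast
  then show ?case
    by (intro exI[of _ 1] exI[of _ w]) simp
next
  case (comp g h)
  from comp.IH(1)[of u] obtain c v where 1: "level v = level u" "\<And>z. chi u (g z) = c * chi v z"
    by blast
  from comp.IH(2)[of v] obtain d w where 2: "level w = level v" "\<And>z. chi v (h z) = d * chi w z"
    by blast
  from 1 2 show ?case
    by (intro exI[of _ "c * d"] exI[of _ w]) simp
qed

text \<open>
  The empty set is left out because the coefficient there, the sum of all entries, is constant on the
  orbit and so contributes no direction to its affine hull.
\<close>

definition active :: "real ^ ('n::finite \<Rightarrow> sign) \<Rightarrow> 'n set \<Rightarrow> bool" where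
  "active x u \<longleftrightarrow> u \<noteq> {} \<and> (\<exists>g\<in>G_OD. fourier (act g x) u \<noteq> 0)"

lemma fourier_0_if_inactive: "\<not> active x u \<Longrightarrow> u \<noteq> {} \<Longrightarrow> g \<in> G_OD \<Longrightarrow> fourier (act g x) u = 0"
  by (auto simp: active_def)

lemma fourier_act_empty: "g \<in> G_OD \<Longrightarrow> fourier (act g x) {} = fourier x {}"
  by (simp add: fourier_act bij_G_OD) (simp add: fourier_def)

text \<open>
  The coefficient of \<open>act g x\<close> at \<open>u\<close> pairs \<open>x\<close> with \<open>chi u \<circ> g\<close>, a multiple of a character of the
  same level.
\<close>

lemma not_active_if_level_vanishes:
  assumes "\<And>v. level v = level u \<Longrightarrow> fourier x v = 0"
  shows "\<not> active x u"
proof -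
  have "fourier (act g x) u = 0" if g: "g \<in> G_OD" for g
  proof -
    from G_OD_permutes_chi[OF g, of u] obtain c v
      where v: "level v = level u" "\<And>z. chi u (g z) = c * chi v z"
      by blast
    have "fourier (act g x) u = c * fourier x v"
      using v(2) by (simp add: fourier_act[OF bij_G_OD[OF g]])
        (simp add: fourier_def sum_distrib_left mult_ac)
    then show ?thesis
      using assms[OF v(1)] by simp
  qed
  then show ?thesis
    by (simp add: active_def)
qed

text \<open>
  If \<open>act g x\<close> has a nonzero coefficient at \<open>u\<close>, then \<open>h\<close> carries this coefficient to \<open>v\<close>.
\<close>

lemma active_transfer:
  assumes u: "active x u" and v: "v \<noteq> {}" and h: "h \<in> G_OD"
    and chi: "\<And>z. chi v (h z) = chi u z"
  shows "active x v"
proof -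
  from u obtain g where g: "g \<in> G_OD" "fourier (act g x) u \<noteq> 0"
    by (auto simp: active_def)
  have "fourier (act (h \<circ> g) x) v = fourier (act g x) u"
    using g(1) h chi by (simp add: act_comp bij_G_OD fourier_act[of h])
      (simp add: fourier_def)
  with g v comp_in_G_OD[OF h g(1)] show ?thesis
    by (auto simp: active_def)
qed

lemma ex_bij_image:
  fixes u v :: "'n::finite set"
  assumes "card u = card v"
  shows "\<exists>p. bij p \<and> p ` u = v"
proof -
  obtain f where f: "bij_betw f u v"
    using finite_same_card_bij[OF finite finite assms] by blast
  have "card (- u) = card (- v)"
    using assms by (simp add: Compl_eq_Diff_UNIV card_Diff_subset)
  then obtain g where g: "bij_betw g (- u) (- v)"
    using finite_same_card_bij[OF finite finite] by blast
  define p where "p = (\<lambda>i. if i \<in> u then f i else g i)"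
  have "bij_betw p (u \<union> - u) (v \<union> - v)"
    unfolding p_def by (rule bij_betw_disjoint_Un[OF f g]) auto
  moreover have "p ` u = v"
    using f by (auto simp: p_def bij_betw_def)
  ultimately show ?thesis
    by auto
qed

lemma active_same_card:
  assumes "active x u" "card u = card v"
  shows "active x v"
proof -
  obtain p where p: "bij p" "p ` v = u"
    using ex_bij_image assms(2) by metis
  moreover have "v \<noteq> {}"
    using assms by (auto simp: active_def)
  ultimately show ?thesis
    using active_transfer[OF assms(1) _ permute_coords_in_G_OD[OF p(1)]]
    by (simp add: chi_permute_coords)
qed

lemma active_insert_iff:
  assumes "odd (card u)" "j \<notin> u"
  shows "active x (insert j u) \<longleftrightarrow> active x u"
proof -
  have "u \<noteq> {}"
    using assms by auto
  then show ?thesis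
    using active_transfer[OF _ _ R_in_G_OD[of j], of x u "insert j u"]
      active_transfer[OF _ _ R_in_G_OD[of j], of x "insert j u" u] assms
    by (auto simp: chi_R_notin chi_R_insert)
qed

text \<open>
  A set of odd size can be enlarged by one element without changing whether it is active, and a set
  of even size already has size \<open>2 * level u\<close>. The existence of \<open>v\<close> excludes the set \<open>u = UNIV\<close> of
  odd size, which cannot be enlarged.
\<close>

lemma active_double_level:
  fixes u v :: "'n::finite set"
  assumes "card v = 2 * level u"
  shows "active x u \<longleftrightarrow> active x v"
proof (cases "even (card u)")
  case True
  then have "card u = card v"
    using assms by (auto simp: level_def)
  then show ?thesis
    using active_same_card by metis
next
  case False
  then have card_v: "card v = Suc (card u)"
    using assms by (auto simp: level_def elim!: oddE)
  then have "u \<noteq> UNIV"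
    by (metis card_mono finite not_less_eq_eq order_refl subset_UNIV)
  then obtain j where j: "j \<notin> u"
    by auto
  then have "card (insert j u) = card v"
    using card_v by simp
  then show ?thesis
    using active_insert_iff[OF False j] active_same_card by metis
qed

section \<open>Affine hull of an orbit\<close>

definition translate :: "('n \<Rightarrow> sign) \<Rightarrow> ('n \<Rightarrow> sign) \<Rightarrow> ('n \<Rightarrow> sign)" where
  "translate w z = (\<lambda>j. w j * z j)"

lemma chi_translate: "chi u (translate w z) = chi u w * chi u z"
  by (simp add: chi_def translate_def sval_mult prod.distrib)

lemma uminus_sign_mult: "- a * b = - (a * b)" for a b :: sign
  by transfer simp

text \<open>
  The translation by \<open>w\<close> composes the sign changes at the coordinates where \<open>w\<close> is \<open>- 1\<close>.
\<close>

lemma translate_in_G_OD: "translate (w :: 'n::finite \<Rightarrow> sign) \<in> G_OD"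
proof -
  have flips: "(\<lambda>z j. if j \<in> u then - z j else z j) \<in> G_OD" for u :: "'n set"
  proof (induction u rule: finite_induct[OF finite])
    case 1
    show ?case
      using id_in_G_OD by (simp add: id_def)
  next
    case (2 i u)
    have "(\<lambda>z j. if j \<in> insert i u then - z j else z j)
        = flip_coord i \<circ> (\<lambda>z j. if j \<in> u then - z j else z j)"
      using 2 by (auto simp: flip_coord_def fun_eq_iff)
    then show ?case
      using comp_in_G_OD[OF flip_coord_in_G_OD 2(3)] by simp
  qed
  have eq: "translate w = (\<lambda>z j. if j \<in> {j. w j = - 1} then - z j else z j)"
  proof (intro ext)
    fix z :: "'n \<Rightarrow> sign" and j
    show "translate w z j = (if j \<in> {j. w j = - 1} then - z j else z j)"
      using sign_cases[of "w j"] by (auto simp: translate_def uminus_sign_mult)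
  qed
  show ?thesis
    unfolding eq by (rule flips)
qed

text \<open>
  Weighting the translates of \<open>y\<close> by a character isolates the part of \<open>y\<close> along that character. This
  is how a single nonzero coefficient in the orbit yields a whole direction of its affine hull.
\<close>

lemma sum_translates:
  "(\<Sum>w\<in>UNIV. chi u w *\<^sub>R act (translate w) y) = fourier y u *\<^sub>R chi_vec u"
  for y :: "real ^ ('n::finite \<Rightarrow> sign)"
proof (rule vec_eq_iff[THEN iffD2], rule allI)
  fix z
  have act: "act (translate w) y $ z = y $ translate w z" for w
    using act_apply[OF bij_G_OD[OF translate_in_G_OD], of w y "translate w z"]
    by (simp add: translate_def flip: mult.assoc)
  have "bij (\<lambda>w. translate w z)"
    by (rule o_bij[of "\<lambda>w. translate w z"]) (auto simp: translate_def fun_eq_iff mult.assoc)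
  then have "(\<Sum>w\<in>UNIV. chi u (translate w z) * y $ translate (translate w z) z)
      = (\<Sum>w\<in>UNIV. chi u w * y $ translate w z)"
    by (rule sum.reindex_bij_betw)
  moreover have "translate (translate w z) z = w" for w
    by (simp add: translate_def mult.assoc)
  ultimately show "(\<Sum>w\<in>UNIV. chi u w *\<^sub>R act (translate w) y) $ z = (fourier y u *\<^sub>R chi_vec u) $ z"
    by (simp add: act chi_translate fourier_def chi_vec_def sum_distrib_left mult_ac)
qed

lemma span_chi_vec_iff:
  "y \<in> span (chi_vec ` S) \<longleftrightarrow> (\<forall>u. u \<notin> S \<longrightarrow> fourier y u = 0)"
proof
  assume y: "y \<in> span (chi_vec ` S)"
  show "\<forall>u. u \<notin> S \<longrightarrow> fourier y u = 0"
  proof (intro allI impI)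
    fix u
    assume "u \<notin> S"
    then have "chi_vec ` S \<subseteq> {y. chi_vec u \<bullet> y = 0}"
      by (auto simp: fourier_chi_vec simp flip: fourier_eq_inner)
    then have "span (chi_vec ` S) \<subseteq> {y. chi_vec u \<bullet> y = 0}"
      by (rule span_minimal) (rule subspace_hyperplane)
    then show "fourier y u = 0"
      using y by (auto simp: fourier_eq_inner)
  qed
next
  assume zero: "\<forall>u. u \<notin> S \<longrightarrow> fourier y u = 0"
  have "(\<Sum>u\<in>UNIV. (fourier y u / 2 ^ CARD('a)) *\<^sub>R chi_vec u) \<in> span (chi_vec ` S)"
  proof (rule span_sum)
    fix u
    show "(fourier y u / 2 ^ CARD('a)) *\<^sub>R chi_vec u \<in> span (chi_vec ` S)"
      using zero by (cases "u \<in> S") (auto intro: span_scale span_base span_zero)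
  qed
  then show "y \<in> span (chi_vec ` S)"
    by (simp flip: fourier_inversion)
qed

lemma dim_span_chi_vec: "dim (span (chi_vec ` S)) = card S"
proof -
  have "inj_on chi_vec S"
    by (rule inj_onI) (metis fourier_chi_vec power_not_zero zero_neq_numeral)
  moreover have "independent (chi_vec ` S)"
  proof (rule pairwise_orthogonal_independent)
    show "pairwise orthogonal (chi_vec ` S)"
      by (auto simp: pairwise_def orthogonal_def fourier_chi_vec simp flip: fourier_eq_inner)
    show "0 \<notin> chi_vec ` S"
      by (auto simp: chi_vec_def vec_eq_iff)
  qed
  ultimately show ?thesis
    by (simp add: dim_eq_card_independent card_image)
qed

text \<open>
  For the inclusion from right to left, let \<open>y = act g x\<close> have a nonzero coefficient at a nonempty
  \<open>u\<close>. The weights \<open>chi u w\<close> sum to zero over \<open>w\<close>, so the combination of translates of \<open>y\<close> in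
  \<open>sum_translates\<close> is unchanged when \<open>x\<close> is subtracted from each translate, and therefore lies in the
  span of the differences.
\<close>

lemma span_orbit_differences:
  "span ((+) (- x) ` orbit_OD x) = span (chi_vec ` {u. active x u})"
proof
  show "span ((+) (- x) ` orbit_OD x) \<subseteq> span (chi_vec ` {u. active x u})"
  proof (rule span_minimal[OF _ subspace_span], rule image_subsetI)
    fix y
    assume "y \<in> orbit_OD x"
    then obtain g where g: "g \<in> G_OD" and y: "y = act g x"
      by (auto simp: orbit_OD_def)
    have "fourier (- x + y) u = 0" if "\<not> active x u" for u
    proof (cases "u = {}")
      case True
      then show ?thesis
        using g by (simp add: y fourier_diff fourier_act_empty)
    next
      case False
      then show ?thesis
        using that g fourier_0_if_inactive[of x u id] fourier_0_if_inactive[of x u g]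
        by (simp add: y fourier_diff id_in_G_OD)
    qed
    then show "- x + y \<in> span (chi_vec ` {u. active x u})"
      by (simp add: span_chi_vec_iff)
  qed
next
  let ?V = "span ((+) (- x) ` orbit_OD x)"
  have "chi_vec u \<in> ?V" if u: "active x u" for u
  proof -
    from u obtain g where g: "g \<in> G_OD" "fourier (act g x) u \<noteq> 0" and "u \<noteq> {}"
      by (auto simp: active_def)
    have "(\<Sum>w\<in>UNIV. chi u w *\<^sub>R (- x + act (translate w \<circ> g) x)) \<in> ?V"
      using g by (intro span_sum span_scale span_base)
        (auto simp: orbit_OD_def comp_in_G_OD translate_in_G_OD)
    also have "(\<Sum>w\<in>UNIV. chi u w *\<^sub>R (- x + act (translate w \<circ> g) x))
        = (\<Sum>w\<in>UNIV. chi u w *\<^sub>R act (translate w) (act g x)) - (\<Sum>w\<in>UNIV. chi u w) *\<^sub>R x"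
      using g(1) by (simp add: act_comp bij_G_OD translate_in_G_OD scaleR_diff_right
        sum_subtractf scaleR_sum_left)
    also have "(\<Sum>w\<in>UNIV. chi u w) = 0"
      using chi_orthogonal[of u "{}"] \<open>u \<noteq> {}\<close> by simp
    finally have "fourier (act g x) u *\<^sub>R chi_vec u \<in> ?V"
      by (simp add: sum_translates)
    from span_scale[OF this, of "inverse (fourier (act g x) u)"] show ?thesis
      using g(2) by simp
  qed
  then show "span (chi_vec ` {u. active x u}) \<subseteq> ?V"
    by (intro span_minimal) auto
qed

theorem affine_hull_orbit:
  "affine hull (orbit_OD x) = {z. \<forall>u. \<not> active x u \<longrightarrow> fourier z u = fourier x u}"
  and aff_dim_orbit: "aff_dim (orbit_OD x) = int (card {u. active x u})"
proof -
  have x: "x \<in> affine hull (orbit_OD x)"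
    using id_in_G_OD by (force simp: orbit_OD_def intro: hull_inc)
  have "z \<in> affine hull (orbit_OD x) \<longleftrightarrow> z - x \<in> span (chi_vec ` {u. active x u})" for z
    unfolding affine_hull_span_gen[OF x] span_orbit_differences by (force simp: image_iff)
  then show "affine hull (orbit_OD x) = {z. \<forall>u. \<not> active x u \<longrightarrow> fourier z u = fourier x u}"
    by (auto simp: span_chi_vec_iff fourier_diff)
  show "aff_dim (orbit_OD x) = int (card {u. active x u})"
    unfolding aff_dim_eq_dim[OF x]
    by (subst dim_span[symmetric]) (simp only: span_orbit_differences dim_span_chi_vec)
qed

section \<open>Fourier coefficients of orthogonal arrays\<close>

text \<open>
  Strength passes down by one column at a time: the rows with prescribed entries on \<open>v\<close> split by
  their sign in a further column \<open>j\<close>, which exists as \<open>card v < s \<le> k\<close>.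
\<close>

lemma orthogonal_array_lower_strength:
  fixes A :: "('n::finite \<Rightarrow> sign) list"
  assumes A: "orthogonal_array lam s A" and s: "s \<le> CARD('n)" and "card v \<le> s"
  shows "card {r. r < length A \<and> (\<forall>j\<in>v. (A ! r) j = c j)} = lam * 2 ^ (s - card v)"
  using \<open>card v \<le> s\<close>
proof (induction "s - card v" arbitrary: v c)
  case 0
  then have v: "card v = s"
    by simp
  then have "card {r. r < length A \<and> (\<forall>j\<in>v. (A ! r) j = c j)} = lam"
    using A unfolding orthogonal_array_def by blast
  then show ?case
    by (simp add: v)
next
  case (Suc m)
  then have "card v < CARD('n)"
    using s by simp
  then obtain j where j: "j \<notin> v"
    by (metis UNIV_I less_irrefl subsetI subset_antisym subset_UNIV)
  let ?rows = "\<lambda>v c. {r. r < length A \<and> (\<forall>j\<in>v. (A ! r) j = c j)}"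
  have m: "m = s - card (insert j v)" "card (insert j v) \<le> s"
    using Suc.hyps(2) j by simp_all
  have IH: "card (?rows (insert j v) (c(j := b))) = lam * 2 ^ m" for b
    using Suc.hyps(1)[OF m] by (simp only: m(1))
  have "?rows v c = ?rows (insert j v) (c(j := 1)) \<union> ?rows (insert j v) (c(j := - 1))"
    using j sign_cases by auto
  also have "card \<dots> = card (?rows (insert j v) (c(j := 1))) + card (?rows (insert j v) (c(j := - 1)))"
    by (rule card_Un_disjoint) auto
  also have "\<dots> = lam * 2 ^ m + lam * 2 ^ m"
    by (simp only: IH)
  finally show ?case
    using Suc.hyps(2)[symmetric] by simp
qed

lemma fourier_frequency_vector:
  "fourier (frequency_vector A) u = (\<Sum>r<length A. chi u (A ! r))"
proof -
  have "fourier (frequency_vector A) u = sum_list (map (chi u) A)"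
  proof (induction A)
    case Nil
    show ?case
      by (simp add: fourier_def frequency_vector_def)
  next
    case (Cons a A)
    have "chi u z * frequency_vector (a # A) $ z
        = chi u z * frequency_vector A $ z + (if z = a then chi u z else 0)" for z
      by (simp add: frequency_vector_def distrib_left)
    then show ?case
      using Cons by (simp add: fourier_def sum.distrib)
  qed
  then show ?thesis
    by (simp add: sum_list_sum_nth atLeast0LessThan)
qed

text \<open>
  Write each sign as \<open>1 - 2y\<close> with \<open>y\<close> the indicator of \<open>- 1\<close> and expand the product. The powers of
  two make the terms of large subsets negligible modulo \<open>2 ^ Suc s\<close>, while those of subsets of size
  at most \<open>s\<close> are known from the strength of the array.
\<close>

lemma chi_expansion:
  "chi u z = (\<Sum>v\<in>Pow u. if \<forall>j\<in>v. z j = - 1 then (- 2) ^ card v else 0)"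
proof -
  have "chi u z = (\<Prod>j\<in>u. (if z j = - 1 then - 2 else 0) + 1)"
    unfolding chi_def
  proof (rule prod.cong[OF refl])
    fix j
    show "sval (z j) = (if z j = - 1 then - 2 else 0) + 1"
      using sign_cases[of "z j"] by auto
  qed
  also have "\<dots> = (\<Sum>v\<in>Pow u. \<Prod>j\<in>v. if z j = - 1 then - 2 else 0)"
    by (simp add: prod_add)
  also have "\<dots> = (\<Sum>v\<in>Pow u. if \<forall>j\<in>v. z j = - 1 then (- 2) ^ card v else 0)"
    by (intro sum.cong) (auto intro: prod_zero)
  finally show ?thesis .
qed

lemma fourier_frequency_vector_expansion:
  "fourier (frequency_vector A) u
    = (\<Sum>v\<in>Pow u. (- 2) ^ card v * real (card {r. r < length A \<and> (\<forall>j\<in>v. (A ! r) j = - 1)}))"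
proof -
  have "fourier (frequency_vector A) u
      = (\<Sum>v\<in>Pow u. \<Sum>r<length A. if \<forall>j\<in>v. (A ! r) j = - 1 then (- 2) ^ card v else 0)"
    unfolding fourier_frequency_vector chi_expansion[of u] by (rule sum.swap)
  also have "\<dots> = (\<Sum>v\<in>Pow u. (- 2) ^ card v
      * real (card {r. r < length A \<and> (\<forall>j\<in>v. (A ! r) j = - 1)}))"
    by (intro sum.cong refl) (simp add: sum.If_cases Int_def mult.commute)
  finally show ?thesis .
qed

context
  fixes lam s :: nat and A :: "('n::finite \<Rightarrow> sign) list"
  assumes array: "orthogonal_array lam s A" and strength_le: "s \<le> CARD('n)"
begin

lemma low_order_term:
  assumes "card v \<le> s"
  shows "(- 2) ^ card v * real (card {r. r < length A \<and> (\<forall>j\<in>v. (A ! r) j = - 1)})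
    = (- 1) ^ card v * (real lam * 2 ^ s)"
proof -
  have "(2::real) ^ s = 2 ^ card v * 2 ^ (s - card v)"
    using assms by (simp flip: power_add)
  then show ?thesis
    using orthogonal_array_lower_strength[OF array strength_le assms, of "\<lambda>_. - 1"]
    by (simp add: power_minus[of 2])
qed

lemma fourier_array_empty: "fourier (frequency_vector A) {} = real lam * 2 ^ s"
  using array by (simp add: fourier_frequency_vector orthogonal_array_def)

lemma fourier_array_eq_0:
  assumes "1 \<le> card u" "card u \<le> s"
  shows "fourier (frequency_vector A) u = 0"
proof -
  have "card v \<le> s" if "v \<in> Pow u" for v
    using that assms(2) card_mono[of u v] by simp
  then have "fourier (frequency_vector A) u = (\<Sum>v\<in>Pow u. (- 1) ^ card v * (real lam * 2 ^ s))"
    unfolding fourier_frequency_vector_expansion by (intro sum.cong low_order_term) auto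
  also have "\<dots> = (\<Sum>v\<in>Pow u. (- 1) ^ card v) * (real lam * 2 ^ s)"
    by (rule sum_distrib_right[symmetric])
  also have "(\<Sum>v\<in>Pow u. (- 1) ^ card v) = (\<Prod>j\<in>u. - 1 + 1 :: real)"
    by (subst prod_add) simp_all
  also have "\<dots> = 0"
    using assms(1) by auto
  finally show ?thesis
    by simp
qed

text \<open>
  In the expansion, a subset of size \<open>i \<le> s\<close> contributes \<open>(- 1) ^ i * \<lambda> * 2 ^ s\<close>, and a larger one a
  multiple of \<open>2 ^ Suc s\<close>. The alternating sum of the binomial coefficients
  \<open>card u choose i\<close> over \<open>i \<le> s\<close> is \<open>(- 1) ^ s * (card u - 1 choose s)\<close>.
\<close>

lemma fourier_array_mod:
  assumes "s < card u"
  obtains M :: int where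
    "fourier (frequency_vector A) u
      = real_of_int (2 ^ s * ((- 1) ^ s * int (lam * (card u - 1 choose s)) + 2 * M))"
proof -
  let ?N = "\<lambda>v. card {r. r < length A \<and> (\<forall>j\<in>v. (A ! r) j = - 1)}"
  let ?low = "{v \<in> Pow u. card v \<le> s}" and ?high = "{v \<in> Pow u. s < card v}"
  define M where "M = (\<Sum>v\<in>?high. (- 1) ^ card v * 2 ^ (card v - Suc s) * int (?N v))"
  have high: "(\<Sum>v\<in>?high. (- 2) ^ card v * real (?N v)) = 2 ^ s * (2 * real_of_int M)"
    unfolding M_def of_int_sum sum_distrib_left
  proof (rule sum.cong[OF refl])
    fix v
    assume "v \<in> ?high"
    then have "(2::real) ^ card v = 2 ^ Suc s * 2 ^ (card v - Suc s)"
      by (simp flip: power_add power_Suc)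
    then show "(- 2) ^ card v * real (?N v)
        = 2 ^ s * (2 * real_of_int ((- 1) ^ card v * 2 ^ (card v - Suc s) * int (?N v)))"
      by (simp add: power_minus[of 2])
  qed
  have "(\<Sum>v\<in>?low. (- 2) ^ card v * real (?N v))
      = (\<Sum>v\<in>?low. (- 1) ^ card v * (real lam * 2 ^ s))"
    by (intro sum.cong low_order_term) auto
  also have "\<dots> = (\<Sum>v\<in>?low. (- 1) ^ card v) * (real lam * 2 ^ s)"
    by (rule sum_distrib_right[symmetric])
  also have "(\<Sum>v\<in>?low. (- 1) ^ card v)
      = (\<Sum>i\<le>s. \<Sum>v | v \<in> ?low \<and> card v = i. (- 1) ^ card v :: real)"
    by (rule sum.group[symmetric]) auto
  also have "\<dots> = (\<Sum>i\<le>s. (real (card u) gchoose i) * (- 1) ^ i)"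
  proof (rule sum.cong[OF refl])
    fix i
    assume "i \<in> {..s}"
    then have "{v. v \<in> ?low \<and> card v = i} = {v. v \<subseteq> u \<and> card v = i}"
      by auto
    then show "(\<Sum>v | v \<in> ?low \<and> card v = i. (- 1) ^ card v) = (real (card u) gchoose i) * (- 1) ^ i"
      by (simp add: n_subsets binomial_gbinomial)
  qed
  also have "\<dots> = (- 1) ^ s * (real (card u) - 1 gchoose s)"
    by (rule gbinomial_sum_lower_neg)
  also have "real (card u) - 1 = real (card u - 1)"
    using assms by (simp add: of_nat_diff)
  finally have low: "(\<Sum>v\<in>?low. (- 2) ^ card v * real (?N v))
      = (- 1) ^ s * real (card u - 1 choose s) * (real lam * 2 ^ s)"
    by (simp add: binomial_gbinomial)
  have "fourier (frequency_vector A) u = (\<Sum>v\<in>?low \<union> ?high. (- 2) ^ card v * real (?N v))"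
    unfolding fourier_frequency_vector_expansion by (rule sum.cong) auto
  also have "\<dots> = (\<Sum>v\<in>?low. (- 2) ^ card v * real (?N v))
      + (\<Sum>v\<in>?high. (- 2) ^ card v * real (?N v))"
    by (rule sum.union_disjoint) auto
  also have "\<dots> = real_of_int (2 ^ s * ((- 1) ^ s * int (lam * (card u - 1 choose s)) + 2 * M))"
    unfolding low high by (simp add: algebra_simps)
  finally show ?thesis
    by (rule that)
qed

lemma even_if_fourier_array_eq_0:
  assumes "s < card u" "fourier (frequency_vector A) u = 0"
  shows "even (lam * (card u - 1 choose s))"
proof -
  obtain M where "real_of_int (2 ^ s * ((- 1) ^ s * int (lam * (card u - 1 choose s)) + 2 * M)) = 0"
    using fourier_array_mod[OF assms(1)] assms(2) by metis
  then have "(- 1) ^ s * int (lam * (card u - 1 choose s)) + 2 * M = 0"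
    by (simp only: of_int_eq_0_iff mult_eq_0_iff) simp
  then have "even ((- 1) ^ s * int (lam * (card u - 1 choose s)))"
    by (metis dvd_0_right dvd_add_left_iff dvd_triv_left)
  then show ?thesis
    by (simp only: even_mult_iff even_power even_of_nat_iff) simp
qed

end

section \<open>The inactive sets\<close>

lemma card_sets_with_card_in:
  assumes "finite W"
  shows "card {u :: 'n::finite set. card u \<in> W} = (\<Sum>i\<in>W. CARD('n) choose i)"
proof -
  have "card {u :: 'n set. card u \<in> W} = (\<Sum>i\<in>W. \<Sum>u | u \<in> {u :: 'n set. card u \<in> W} \<and> card u = i. 1)"
    using assms by (subst sum.group) auto
  also have "\<dots> = (\<Sum>i\<in>W. CARD('n) choose i)"
  proof (rule sum.cong[OF refl])
    fix i
    assume "i \<in> W"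
    then have "{u. u \<in> {u :: 'n set. card u \<in> W} \<and> card u = i} = {u. u \<subseteq> UNIV \<and> card u = i}"
      by auto
    then show "(\<Sum>u | u \<in> {u :: 'n set. card u \<in> W} \<and> card u = i. 1) = CARD('n) choose i"
      by (simp only: n_subsets[OF finite] card_eq_sum[symmetric])
  qed
  finally show ?thesis .
qed

text \<open>
  These two sets are the witnesses \<open>T\<close> and \<open>T'\<close>. An inactive pair of sizes \<open>d - 1\<close> and \<open>d\<close> is recorded
  by its even member \<open>d\<close>.
\<close>

definition inactive_tops :: "nat \<Rightarrow> real ^ ('n::finite \<Rightarrow> sign) \<Rightarrow> nat set" where
  "inactive_tops s x = {d. even d \<and> s + 2 \<le> d \<and> d \<le> CARD('n) \<and> (\<forall>u. card u = d \<longrightarrow> \<not> active x u)}"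

definition inactive_last :: "real ^ ('n::finite \<Rightarrow> sign) \<Rightarrow> nat set" where
  "inactive_last x = {d. odd d \<and> d = CARD('n) \<and> \<not> active x UNIV}"

lemma le_even_if_half_eq:
  fixes a b s :: nat
  assumes "(a + 1) div 2 = (b + 1) div 2" "1 \<le> b" "b \<le> s" "even s"
  shows "1 \<le> a" and "a \<le> s"
  using assms by presburger+

text \<open>
  A set has size at most \<open>s\<close>, or a larger size that belongs to a pair of sizes up to \<open>k\<close>, or the
  lone size \<open>k\<close>, for odd \<open>k\<close>. Evenness of \<open>s\<close> keeps the first kind closed under equality of levels,
  so that the vanishing coefficients of \<open>x\<close> there make these sets inactive.
\<close>

lemma active_iff_card:
  fixes x :: "real ^ ('n::finite \<Rightarrow> sign)"
  assumes "even s" and zero: "\<And>v. 1 \<le> card v \<Longrightarrow> card v \<le> s \<Longrightarrow> fourier x v = 0"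
  shows "active x u \<longleftrightarrow>
    card u \<notin> {0..s} \<union> (inactive_tops s x \<union> (\<lambda>d. d - 1) ` inactive_tops s x \<union> inactive_last x)"
proof -
  let ?T = "inactive_tops s x"
  have le: "card u \<le> CARD('n)"
    by (simp add: card_mono)
  consider (low) "card u \<le> s" | (pair) "s < card u" "2 * level u \<le> CARD('n)"
    | (last) "s < card u" "CARD('n) < 2 * level u"
    by linarith
  then show ?thesis
  proof cases
    case low
    have "\<not> active x u"
    proof (cases "u = {}")
      case True
      then show ?thesis
        by (simp add: active_def)
    next
      case False
      then have "1 \<le> card u"
        by (simp add: Suc_le_eq card_gt_0_iff)
      then have "1 \<le> card v" "card v \<le> s" if "level v = level u" for v
        using le_even_if_half_eq[of "card v" "card u" s] that low \<open>even s\<close> \<open>1 \<le> card u\<close>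
        by (simp_all add: level_def)
      then show ?thesis
        using zero by (intro not_active_if_level_vanishes) auto
    qed
    then show ?thesis
      using low by simp
  next
    case pair
    then obtain v :: "'n set" where v: "card v = 2 * level u"
      using obtain_subset_with_card_n[of "2 * level u" "UNIV :: 'n set"] by auto
    have "s + 2 \<le> 2 * level u"
      using pair(1) \<open>even s\<close> unfolding level_def by presburger
    then have "2 * level u \<in> ?T \<longleftrightarrow> \<not> active x v"
      using pair(2) v active_same_card unfolding inactive_tops_def by (auto 4 3)
    then have "active x u \<longleftrightarrow> 2 * level u \<notin> ?T"
      using active_double_level[OF v] by blast
    moreover have "card u \<in> ?T \<union> (\<lambda>d. d - 1) ` ?T \<longleftrightarrow> 2 * level u \<in> ?T"
    proof
      assume "card u \<in> ?T \<union> (\<lambda>d. d - 1) ` ?T"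
      then consider "card u \<in> ?T" | d where "d \<in> ?T" "card u = d - 1"
        by auto
      then show "2 * level u \<in> ?T"
      proof cases
        case 1
        then have "2 * level u = card u"
          by (auto simp: inactive_tops_def level_def)
        with 1 show ?thesis
          by simp
      next
        case 2
        then have "2 * level u = d"
          by (auto simp: inactive_tops_def level_def elim!: evenE)
        with 2 show ?thesis
          by simp
      qed
    next
      assume "2 * level u \<in> ?T"
      moreover have "card u = 2 * level u \<or> card u = 2 * level u - 1"
        using pair(1) by (auto simp: level_def)
      ultimately show "card u \<in> ?T \<union> (\<lambda>d. d - 1) ` ?T"
        by auto
    qed
    moreover have "card u \<notin> inactive_last x"
    proof
      assume "card u \<in> inactive_last x"
      then have "odd (card u)" "card u = CARD('n)"
        by (auto simp: inactive_last_def)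
      with pair(2) show False
        unfolding level_def by presburger
    qed
    ultimately show ?thesis
      using pair(1) by auto
  next
    case last
    then have card: "card u = CARD('n)" and odd: "odd (CARD('n))"
      using le by (auto simp: level_def)
    then have "u = UNIV"
      by (simp add: card_subset_eq)
    moreover have "card u \<notin> ?T \<union> (\<lambda>d. d - 1) ` ?T"
      using card odd by (auto simp: inactive_tops_def)
    ultimately show ?thesis
      using last(1) card odd by (auto simp: inactive_last_def)
  qed
qed

theorem theorem8:
  fixes lam s :: nat
    and A :: "('n::finite \<Rightarrow> sign) list"
    and x :: "real ^ ('n \<Rightarrow> sign)"
  assumes "lam \<ge> 1"
    and "even s" and "1 \<le> s" and "s \<le> CARD('n)"
    and "orthogonal_array lam s A"
    and "x = frequency_vector A"
  shows "\<exists>T T'. T \<subseteq> Omega1 lam s CARD('n) \<and> T' \<subseteq> Omega1' CARD('n) \<and>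
    aff_dim (convex hull (orbit_OD x)) =
      2 ^ CARD('n) - (\<Sum>j = 0..s. int (CARD('n) choose j))
        - (\<Sum>d\<in>T. int (CARD('n) choose (d - 1)) + int (CARD('n) choose d))
        - (if card T' = 1 then 1 else 0) \<and>
    affine hull (convex hull (orbit_OD x)) = affine hull (orbit_OD x) \<and>
    affine hull (orbit_OD x) =
      {z. \<forall>i. J z {} i = real lam * 2 ^ s \<and>
              (\<forall>u. 1 \<le> card u \<and> card u \<le> s \<longrightarrow> J z u i = 0) \<and>
              (\<forall>u. card u \<in> T \<union> (\<lambda>d. d - 1) ` T \<longrightarrow> J z u i = 0) \<and>
              (card T' = 1 \<longrightarrow> J z UNIV i = 0)}"
proof -
  let ?k = "CARD('n)"
  define T where "T = inactive_tops s x"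
  define T' where "T' = inactive_last x"
  define low where "low = {0..s}"
  define T1 where "T1 = (\<lambda>d. d - 1) ` T"
  have zero: "fourier x v = 0" if "1 \<le> card v" "card v \<le> s" for v
    using fourier_array_eq_0 assms that by simp
  have fourier_empty: "fourier x {} = real lam * 2 ^ s"
    using fourier_array_empty assms by simp
  have active: "active x u \<longleftrightarrow> card u \<notin> low \<union> (T \<union> T1 \<union> T')" for u
    unfolding T_def T'_def T1_def low_def using active_iff_card[OF \<open>even s\<close> zero] .
  have inactive_zero: "fourier x u = 0" if "\<not> active x u" "u \<noteq> {}" for u
    using fourier_0_if_inactive[OF that id_in_G_OD] by simp
  have T_props: "even d" "s + 2 \<le> d" "d \<le> ?k" if "d \<in> T" for d
    using that by (auto simp: T_def inactive_tops_def)
  have T'_cases: "T' = {} \<or> T' = {?k} \<and> odd ?k"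
    by (auto simp: T'_def inactive_last_def)

  \<comment> \<open>Inactivity includes that the coefficient of \<open>x\<close> itself vanishes, so the congruence applies.\<close>
  have "T \<subseteq> Omega1 lam s ?k"
  proof
    fix d
    assume d: "d \<in> T"
    then obtain u :: "'n set" where u: "card u = d"
      using T_props obtain_subset_with_card_n[of d "UNIV :: 'n set"] by auto
    with d have "fourier x u = 0"
      using T_props[OF d] by (intro inactive_zero) (auto simp: active)
    then have "even (lam * (d - 1 choose s))"
      using even_if_fourier_array_eq_0[of lam s A u] assms u T_props[OF d] by simp
    moreover have "d - 1 choose (d - s - 1) = (d - 1 choose s)"
      using T_props[OF d] binomial_symmetric[of s "d - 1"] by (simp add: diff_commute)
    ultimately show "d \<in> Omega1 lam s ?k"
      using T_props[OF d] by (simp add: Omega1_def cong_0_iff)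
  qed
  moreover have "T' \<subseteq> Omega1' ?k"
    using T'_cases by (auto simp: Omega1'_def)
  moreover have "aff_dim (convex hull (orbit_OD x)) =
      2 ^ ?k - (\<Sum>j = 0..s. int (?k choose j))
        - (\<Sum>d\<in>T. int (?k choose (d - 1)) + int (?k choose d))
        - (if card T' = 1 then 1 else 0)"
  proof -
    let ?W = "low \<union> (T \<union> T1 \<union> T')"
    \<comment> \<open>Count the inactive sets by size; the four groups of sizes are disjoint by parity and range.\<close>
    have fin: "finite low" "finite T" "finite T1" "finite T'"
      using T'_cases by (auto simp: low_def T1_def T_def inactive_tops_def)
    have "{u. active x u} = - {u. card u \<in> ?W}"
      using active by auto
    moreover have "int (card (- S)) = 2 ^ ?k - int (card S)" for S :: "'n set set"
      using card_Pow[of "UNIV :: 'n set"] card_mono[of UNIV S]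
      by (simp add: Compl_eq_Diff_UNIV card_Diff_subset of_nat_diff)
    ultimately have "int (card {u. active x u}) = 2 ^ ?k - int (card {u :: 'n set. card u \<in> ?W})"
      by simp
    also have "card {u :: 'n set. card u \<in> ?W} = (\<Sum>i\<in>?W. ?k choose i)"
      using fin by (intro card_sets_with_card_in) auto
    also have "\<dots> = (\<Sum>i\<in>low. ?k choose i) + ((\<Sum>i\<in>T. ?k choose i) + (\<Sum>i\<in>T1. ?k choose i)
        + (\<Sum>i\<in>T'. ?k choose i))"
    proof -
      have T: "even i \<and> s < i" if "i \<in> T" for i
        using T_props[OF that] by simp
      have T1: "odd i \<and> s < i \<and> i < ?k" if "i \<in> T1" for i
      proof -
        from that obtain d where d: "d \<in> T" "i = d - 1"
          by (auto simp: T1_def)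
        then have "d = Suc i"
          using T_props(2)[OF d(1)] by simp
        then show ?thesis
          using T_props[OF d(1)] by simp
      qed
      have T': "i = ?k \<and> odd i \<and> s < i" if "i \<in> T'" for i
      proof -
        from that have i: "i = ?k" "odd i"
          using T'_cases by auto
        then have "s \<noteq> i"
          using \<open>even s\<close> by auto
        then show ?thesis
          using i \<open>s \<le> ?k\<close> by simp
      qed
      have "T \<inter> T1 = {}"
        using T T1 by blast
      moreover have "(T \<union> T1) \<inter> T' = {}"
        using T T1 T' by blast
      moreover have "low \<inter> (T \<union> T1 \<union> T') = {}"
        using T T1 T' by (fastforce simp: low_def)
      ultimately show ?thesis
        using fin by (simp add: sum.union_disjoint)
    qed
    also have "(\<Sum>i\<in>T1. ?k choose i) = (\<Sum>d\<in>T. ?k choose (d - 1))"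
    proof -
      have "d = e" if "d \<in> T" "e \<in> T" "d - 1 = e - 1" for d e
        using that(3) T_props(2)[OF that(1)] T_props(2)[OF that(2)] by linarith
      then have "inj_on (\<lambda>d. d - 1) T"
        by (rule inj_onI)
      then show ?thesis
        unfolding T1_def by (simp add: sum.reindex)
    qed
    also have "(\<Sum>i\<in>T'. ?k choose i) = (if card T' = 1 then 1 else 0)"
      using T'_cases by auto
    finally show ?thesis
      by (simp add: aff_dim_convex_hull aff_dim_orbit low_def sum.distrib)
  qed
  moreover have "affine hull (orbit_OD x) =
      {z. \<forall>i. J z {} i = real lam * 2 ^ s \<and>
              (\<forall>u. 1 \<le> card u \<and> card u \<le> s \<longrightarrow> J z u i = 0) \<and>
              (\<forall>u. card u \<in> T \<union> (\<lambda>d. d - 1) ` T \<longrightarrow> J z u i = 0) \<and>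
              (card T' = 1 \<longrightarrow> J z UNIV i = 0)}" (is "_ = ?R")
  proof -
    have "z \<in> affine hull (orbit_OD x) \<longleftrightarrow> z \<in> ?R" for z
    proof -
      have empty_inactive: "\<not> active x {}"
        by (simp add: active_def)
      have top: "card T' = 1 \<longleftrightarrow> T' = {?k}"
        using T'_cases by auto
      have "z \<in> affine hull (orbit_OD x) \<longleftrightarrow>
          (\<forall>u. \<not> active x u \<longrightarrow> fourier z u = fourier x u)"
        by (simp only: affine_hull_orbit mem_Collect_eq)
      also have "\<dots> \<longleftrightarrow>
          fourier z {} = real lam * 2 ^ s \<and> (\<forall>u. u \<noteq> {} \<and> \<not> active x u \<longrightarrow> fourier z u = 0)"
        using inactive_zero fourier_empty empty_inactive by metis
      also have "(\<forall>u. u \<noteq> {} \<and> \<not> active x u \<longrightarrow> fourier z u = 0) \<longleftrightarrow>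
          (\<forall>u. 1 \<le> card u \<and> card u \<le> s \<longrightarrow> fourier z u = 0) \<and>
          (\<forall>u. card u \<in> T \<union> T1 \<longrightarrow> fourier z u = 0) \<and> (card T' = 1 \<longrightarrow> fourier z UNIV = 0)"
        (is "?lhs \<longleftrightarrow> ?rhs")
      proof
        assume ?lhs
        then have L: "fourier z u = 0" if "u \<noteq> {}" "card u \<in> low \<union> (T \<union> T1 \<union> T')" for u
          using that active by blast
        show ?rhs
        proof (intro conjI allI impI)
          fix u :: "'n set"
          assume "1 \<le> card u \<and> card u \<le> s"
          then show "fourier z u = 0"
            by (intro L) (auto simp: low_def)
        next
          fix u :: "'n set"
          assume u: "card u \<in> T \<union> T1"
          then obtain d where "d \<in> T" "card u = d \<or> card u = d - 1"
            by (auto simp: T1_def)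
          then have "0 < card u"
            using T_props(2)[of d] by linarith
          then show "fourier z u = 0"
            using u by (intro L) auto
        next
          assume "card T' = 1"
          then have "?k \<in> T'"
            using top by blast
          then show "fourier z UNIV = 0"
            by (intro L) auto
        qed
      next
        assume R: ?rhs
        show ?lhs
        proof (intro allI impI)
          fix u :: "'n set"
          assume u: "u \<noteq> {} \<and> \<not> active x u"
          then have "1 \<le> card u"
            by (simp add: Suc_le_eq card_gt_0_iff)
          moreover have "u = UNIV" if "card u = ?k"
            using that by (simp add: card_subset_eq)
          ultimately show "fourier z u = 0"
            using u R T'_cases by (auto simp: active low_def)
        qed
      qed
      finally show ?thesis
        by (simp add: J_eq_0_iff) (simp add: J_eq_fourier T1_def)
    qed
    then show ?thesis
      by blast
  qed
  ultimately show ?thesis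
    by (intro exI[of _ T] exI[of _ T']) simp
qed

end
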